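(* For every integer $n \geq 1$, the following hold: (i) The minimum degree of $\mathcal{P}_e(SD_{8n})$ is $1$. (ii) The independence number of $\mathcal{P}_e(SD_{8n})$ is $3n+1$. (iii) The matching number of $\mathcal{P}_e(SD_{8n})$ is $3n$. (iv) The strong metric dimension of $\mathcal{P}_e(SD_{8n})$ is $8n-3$.
   Context: $SD_{8n} = \langle a, b : a^{4n} = b^2 = e,\ ba = a^{2n-1}b \rangle$ is the semidihedral group, of order $8n$. The enhanced power graph $\mathcal{P}_e(G)$ of a group $G$ is the simple undirected graph with vertex set $G$ in which two distinct vertices are adjacent if and only if they belong to a common cyclic subgroup of $G$. The independence number is the largest cardinality of a set of pairwise non-adjacent vertices; the matching number is the maximum cardinality of a set of edges no two of which share an endpoint. For vertices $u,v$ of a graph $\Gamma$, a vertex $z$ strongly resolves $u$ and $v$ if there is a shortest path from $z$ to $u$ containing $v$, or a shortest path from $z$ to $v$ containing $u$; a strong resolving set is a set $U$ of vertices such that every pair of (distinct) vertices of $\Gamma$ is strongly resolved by some vertex of $U$; the strong metric dimension is the least cardinality of a strong resolving set. *)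

theory Defs
  imports "HOL-Algebra.Elementary_Groups"
begin

section \<open>Groups given by generators and relations\<close>

text \<open>
  A word is a list of letters \<open>(x, s)\<close>, standing for the generator \<open>x\<close> if \<open>s = True\<close> and for
  its formal inverse if \<open>s = False\<close>. The generating set is the whole type \<open>'g\<close>. A relation
  \<open>u = v\<close> is a pair \<open>(u, v)\<close> of words.
\<close>

type_synonym 'g word = "('g \<times> bool) list"

inductive word_eq :: "('g word \<times> 'g word) set \<Rightarrow> 'g word \<Rightarrow> 'g word \<Rightarrow> bool"
  for R :: "('g word \<times> 'g word) set" where
  refl: "word_eq R w w"
| sym: "word_eq R u v \<Longrightarrow> word_eq R v u"
| trans: "word_eq R u v \<Longrightarrow> word_eq R v w \<Longrightarrow> word_eq R u w"
| append: "word_eq R u v \<Longrightarrow> word_eq R u' v' \<Longrightarrow> word_eq R (u @ u') (v @ v')"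
| cancel: "word_eq R [(x, s), (x, \<not> s)] []"
| relation: "(u, v) \<in> R \<Longrightarrow> word_eq R u v"

definition word_rel :: "('g word \<times> 'g word) set \<Rightarrow> ('g word \<times> 'g word) set" where
  "word_rel R = {(u, v). word_eq R u v}"

definition presented_group :: "('g word \<times> 'g word) set \<Rightarrow> 'g word set monoid" where
  "presented_group R =
     \<lparr>carrier = UNIV // word_rel R,
      mult = (\<lambda>X Y. \<Union>u\<in>X. \<Union>v\<in>Y. word_rel R `` {u @ v}),
      one = word_rel R `` {[]}\<rparr>"

lemma equiv_word_rel: "equiv UNIV (word_rel R)"
  by (rule equivI)
     (auto simp: word_rel_def refl_on_def sym_def trans_def
        intro: word_eq.refl word_eq.sym word_eq.trans)

lemma mult_presented_group:
  "word_rel R `` {u} \<otimes>\<^bsub>presented_group R\<^esub> word_rel R `` {v} = word_rel R `` {u @ v}"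
proof -
  have "congruent2 (word_rel R) (word_rel R) (\<lambda>u v. word_rel R `` {u @ v})"
    by (rule congruent2I')
       (auto simp: word_rel_def intro: word_eq.append word_eq.sym word_eq.trans)
  from UN_equiv_class2 [OF equiv_word_rel equiv_word_rel this]
  show ?thesis by (simp add: presented_group_def)
qed

lemma word_eq_left_inverse:
  "word_eq R (rev (map (\<lambda>(x, s). (x, \<not> s)) w) @ w) []"
proof (induction w)
  case Nil
  show ?case by (simp add: word_eq.refl)
next
  case (Cons l w)
  obtain x s where l: "l = (x, s)" by (cases l)
  let ?v = "rev (map (\<lambda>(x, s). (x, \<not> s)) w)"
  have "word_eq R [(x, \<not> s), (x, s)] []"
    using word_eq.cancel [of R x "\<not> s"] by simp
  then have "word_eq R ([(x, \<not> s), (x, s)] @ w) ([] @ w)"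
    by (rule word_eq.append [OF _ word_eq.refl])
  then have "word_eq R (?v @ ([(x, \<not> s), (x, s)] @ w)) (?v @ ([] @ w))"
    by (rule word_eq.append [OF word_eq.refl])
  then show ?case using Cons.IH l by (auto intro: word_eq.trans)
qed

lemma group_presented_group: "group (presented_group R)"
proof (rule groupI)
  have car: "\<exists>u. X = word_rel R `` {u}" if "X \<in> carrier (presented_group R)" for X
    using that by (auto simp: presented_group_def quotient_def)
  have cls: "word_rel R `` {u} \<in> carrier (presented_group R)" for u
    by (simp add: presented_group_def quotientI)
  have one: "\<one>\<^bsub>presented_group R\<^esub> = word_rel R `` {[]}"
    by (simp add: presented_group_def)
  show "\<one>\<^bsub>presented_group R\<^esub> \<in> carrier (presented_group R)"
    by (simp only: one cls)
  fix X assume X: "X \<in> carrier (presented_group R)"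
  then obtain u where u: "X = word_rel R `` {u}" using car by blast
  show "\<one>\<^bsub>presented_group R\<^esub> \<otimes>\<^bsub>presented_group R\<^esub> X = X"
    by (simp add: one u mult_presented_group)
  have "word_rel R `` {rev (map (\<lambda>(x, s). (x, \<not> s)) u) @ u} = word_rel R `` {[]}"
    by (rule equiv_class_eq [OF equiv_word_rel]) (simp add: word_rel_def word_eq_left_inverse)
  then show "\<exists>Y\<in>carrier (presented_group R). Y \<otimes>\<^bsub>presented_group R\<^esub> X = \<one>\<^bsub>presented_group R\<^esub>"
    using cls by (metis one u mult_presented_group)
  fix Y assume "Y \<in> carrier (presented_group R)"
  then obtain v where v: "Y = word_rel R `` {v}" using car by blast
  show "X \<otimes>\<^bsub>presented_group R\<^esub> Y \<in> carrier (presented_group R)"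
    by (simp only: u v mult_presented_group cls)
  fix Z assume "Z \<in> carrier (presented_group R)"
  then obtain w where w: "Z = word_rel R `` {w}" using car by blast
  show "X \<otimes>\<^bsub>presented_group R\<^esub> Y \<otimes>\<^bsub>presented_group R\<^esub> Z =
        X \<otimes>\<^bsub>presented_group R\<^esub> (Y \<otimes>\<^bsub>presented_group R\<^esub> Z)"
    by (simp add: u v w mult_presented_group)
qed


section \<open>The semidihedral group\<close>

datatype sd_gen = Gen_a | Gen_b

abbreviation word_a :: "nat \<Rightarrow> sd_gen word" where
  "word_a k \<equiv> replicate k (Gen_a, True)"

abbreviation word_b :: "nat \<Rightarrow> sd_gen word" where
  "word_b k \<equiv> replicate k (Gen_b, True)"

text \<open>The parameter \<open>n\<close> gives the group of order \<open>8n\<close>; it is meant for \<open>n \<ge> 1\<close>.\<close>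

definition semidihedral :: "nat \<Rightarrow> sd_gen word set monoid" where
  "semidihedral n = presented_group
     {(word_a (4 * n), []),
      (word_b 2, []),
      (word_b 1 @ word_a 1, word_a (2 * n - 1) @ word_b 1)}"


section \<open>Simple graphs and their invariants\<close>

text \<open>Edges are two-element sets of vertices.\<close>

record 'v sgraph =
  vertices :: "'v set"
  edges :: "'v set set"

definition adjacent :: "'v sgraph \<Rightarrow> 'v \<Rightarrow> 'v \<Rightarrow> bool" where
  "adjacent \<Gamma> u v \<longleftrightarrow> {u, v} \<in> edges \<Gamma>"

text \<open>
  The numerical invariants below are meant for finite nonempty graphs, where every \<open>Min\<close> and
  \<open>Max\<close> is taken over a finite nonempty set.
\<close>

definition degree :: "'v sgraph \<Rightarrow> 'v \<Rightarrow> nat" where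
  "degree \<Gamma> v = card {w \<in> vertices \<Gamma>. adjacent \<Gamma> v w}"

definition min_degree :: "'v sgraph \<Rightarrow> nat" where
  "min_degree \<Gamma> = Min (degree \<Gamma> ` vertices \<Gamma>)"

definition independent_set :: "'v sgraph \<Rightarrow> 'v set \<Rightarrow> bool" where
  "independent_set \<Gamma> S \<longleftrightarrow>
     S \<subseteq> vertices \<Gamma> \<and> pairwise (\<lambda>u v. \<not> adjacent \<Gamma> u v) S"

definition independence_number :: "'v sgraph \<Rightarrow> nat" where
  "independence_number \<Gamma> = Max (card ` {S. independent_set \<Gamma> S})"

definition matching :: "'v sgraph \<Rightarrow> 'v set set \<Rightarrow> bool" where
  "matching \<Gamma> M \<longleftrightarrow> M \<subseteq> edges \<Gamma> \<and> pairwise disjnt M"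

definition matching_number :: "'v sgraph \<Rightarrow> nat" where
  "matching_number \<Gamma> = Max (card ` {M. matching \<Gamma> M})"

definition path_between :: "'v sgraph \<Rightarrow> 'v \<Rightarrow> 'v list \<Rightarrow> 'v \<Rightarrow> bool" where
  "path_between \<Gamma> u p v \<longleftrightarrow>
     p \<noteq> [] \<and> hd p = u \<and> last p = v \<and> set p \<subseteq> vertices \<Gamma> \<and>
     distinct p \<and> successively (adjacent \<Gamma>) p"

definition shortest_path :: "'v sgraph \<Rightarrow> 'v \<Rightarrow> 'v list \<Rightarrow> 'v \<Rightarrow> bool" where
  "shortest_path \<Gamma> u p v \<longleftrightarrow>
     path_between \<Gamma> u p v \<and> (\<forall>q. path_between \<Gamma> u q v \<longrightarrow> length p \<le> length q)"

definition strongly_resolves :: "'v sgraph \<Rightarrow> 'v \<Rightarrow> 'v \<Rightarrow> 'v \<Rightarrow> bool" where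
  "strongly_resolves \<Gamma> z u v \<longleftrightarrow>
     (\<exists>p. shortest_path \<Gamma> z p u \<and> v \<in> set p) \<or> (\<exists>p. shortest_path \<Gamma> z p v \<and> u \<in> set p)"

definition strong_resolving_set :: "'v sgraph \<Rightarrow> 'v set \<Rightarrow> bool" where
  "strong_resolving_set \<Gamma> U \<longleftrightarrow>
     U \<subseteq> vertices \<Gamma> \<and>
     (\<forall>u\<in>vertices \<Gamma>. \<forall>v\<in>vertices \<Gamma>. u \<noteq> v \<longrightarrow> (\<exists>z\<in>U. strongly_resolves \<Gamma> z u v))"

definition strong_metric_dimension :: "'v sgraph \<Rightarrow> nat" where
  "strong_metric_dimension \<Gamma> = Min (card ` {U. strong_resolving_set \<Gamma> U})"


section \<open>The enhanced power graph\<close>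

definition enhanced_power_graph :: "'a monoid \<Rightarrow> 'a sgraph" where
  "enhanced_power_graph G =
     \<lparr>vertices = carrier G,
      edges = {{x, y} | x y. x \<in> carrier G \<and> y \<in> carrier G \<and> x \<noteq> y \<and>
        (\<exists>H. subgroup H G \<and> cyclic_group (G\<lparr>carrier := H\<rparr>) \<and> x \<in> H \<and> y \<in> H)}\<rparr>"

end

theory Submission
  imports Defs "HOL-Algebra.Multiplicative_Group"
begin

text \<open>
  Every element is \<open>a\<^sup>i\<close> or \<open>a\<^sup>i b\<close>. Since \<open>(a\<^sup>i b)\<^sup>2 = a\<^bsup>2ni\<^esup>\<close>, the maximal cyclic
  subgroups are \<open>\<langle>a\<rangle>\<close>, the \<open>2n\<close> groups \<open>{1, a\<^sup>i b}\<close> with \<open>i\<close> even, and the \<open>n\<close> groups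
  \<open>{1, a\<^bsup>2n\<^esup>, a\<^sup>i b, a\<^bsup>2n+i\<^esup> b}\<close> with \<open>i\<close> odd. So the graph consists of a clique of order \<open>4n\<close>,
  \<open>2n\<close> pendant vertices at \<open>1\<close>, and \<open>n\<close> cliques of order 4 glued along the edge \<open>{1, a\<^bsup>2n\<^esup>}\<close>,
  and the invariants can be read off. For the strong metric dimension: as \<open>1\<close> is adjacent to
  everything, the complement of a strong resolving set is a clique without two vertices with the
  same closed neighbourhood, hence has at most three elements.
\<close>

section \<open>A graph of cliques glued along an edge\<close>

text \<open>Removing two elements at a time pairs up the whole set; inside a clique these pairs form
  a perfect matching.\<close>

lemma perfect_matching_exists:
  assumes "finite A" "card A = 2 * m"
  shows "\<exists>M. card M = m \<and> finite M \<and> (\<forall>E\<in>M. \<exists>u\<in>A. \<exists>v\<in>A. u \<noteq> v \<and> E = {u, v}) \<and> pairwise disjnt M"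
  using assms
proof (induction m arbitrary: A)
  case 0
  show ?case by (rule exI [of _ "{}"]) auto
next
  case (Suc m)
  obtain u where u: "u \<in> A" using Suc.prems by fastforce
  then have "card (A - {u}) = Suc (2 * m)" using Suc.prems by simp
  then obtain v where v: "v \<in> A - {u}" by (metis card_Suc_eq insertI1)
  have "card (A - {u, v}) = 2 * m"
    using Suc.prems u v by (auto simp: card_Diff_subset card_insert_if)
  then obtain M where M: "card M = m" "finite M" "pairwise disjnt M"
    "\<forall>E\<in>M. \<exists>u'\<in>A - {u, v}. \<exists>v'\<in>A - {u, v}. u' \<noteq> v' \<and> E = {u', v'}"
    using Suc.IH [of "A - {u, v}"] Suc.prems by auto
  have out: "\<forall>E\<in>M. u \<notin> E \<and> v \<notin> E" using M(4) by fastforce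
  have "\<forall>E\<in>insert {u, v} M. \<exists>u\<in>A. \<exists>v\<in>A. u \<noteq> v \<and> E = {u, v}"
    using M(4) u v by (metis DiffE insertI1 insert_iff)
  moreover have "pairwise disjnt (insert {u, v} M)"
    using M(3) out by (auto simp: pairwise_insert disjnt_def)
  moreover have "card (insert {u, v} M) = Suc m"
    using M(1,2) out by (subst card_insert_disjoint) auto
  ultimately show ?case using M(2) by (intro exI [of _ "insert {u, v} M"]) auto
qed

text \<open>The graph stripped of its group: \<open>A\<close> is a clique with both hubs, the
  vertices of \<open>I\<close> hang on \<open>e\<close>, and each \<open>q\<close> in
  \<open>Q\<close> spans a 4-clique \<open>{e, z, q, \<sigma> q}\<close>. \<open>Q\<close> holds one
  representative of each pair, and \<open>\<sigma>\<close> gives its partner.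
  \<open>edge_is_pair\<close> is stated separately because \<open>adjacent\<close> cannot see edges
  of any other shape.\<close>

locale rosette =
  fixes \<Gamma> :: "'v sgraph" and A I Q :: "'v set" and \<sigma> :: "'v \<Rightarrow> 'v" and e z :: 'v
  assumes vertices: "vertices \<Gamma> = A \<union> I \<union> Q \<union> \<sigma> ` Q"
    and finite: "finite A" "finite I" "finite Q"
    and disjoint: "A \<inter> I = {}" "A \<inter> Q = {}" "A \<inter> \<sigma> ` Q = {}"
      "I \<inter> Q = {}" "I \<inter> \<sigma> ` Q = {}" "Q \<inter> \<sigma> ` Q = {}"
    and inj: "inj_on \<sigma> Q"
    and hubs: "e \<in> A" "z \<in> A" "e \<noteq> z"
    and edge_is_pair: "E \<in> edges \<Gamma> \<Longrightarrow> \<exists>u v. E = {u, v}"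
    and adjacent_iff: "adjacent \<Gamma> u v \<longleftrightarrow>
      u \<in> vertices \<Gamma> \<and> v \<in> vertices \<Gamma> \<and> u \<noteq> v \<and>
      (u = e \<or> v = e \<or> u \<in> A \<and> v \<in> A \<or>
       u = z \<and> v \<in> Q \<union> \<sigma> ` Q \<or> v = z \<and> u \<in> Q \<union> \<sigma> ` Q \<or>
       u \<in> Q \<and> v = \<sigma> u \<or> v \<in> Q \<and> u = \<sigma> v)"
begin

lemma distinct_parts [simp]:
  "x \<in> A \<Longrightarrow> x \<notin> I" "x \<in> A \<Longrightarrow> x \<notin> Q" "x \<in> I \<Longrightarrow> x \<notin> Q"
  "x \<in> Q \<Longrightarrow> \<sigma> x \<notin> A" "x \<in> Q \<Longrightarrow> \<sigma> x \<notin> I" "x \<in> Q \<Longrightarrow> \<sigma> x \<notin> Q"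
  "x \<in> Q \<Longrightarrow> y \<in> Q \<Longrightarrow> \<sigma> x = \<sigma> y \<longleftrightarrow> x = y"
  using disjoint inj_on_eq_iff [OF inj] by auto

lemma distinct_members [simp]:
  "x \<in> Q \<Longrightarrow> y \<in> A \<Longrightarrow> \<sigma> x \<noteq> y" "x \<in> Q \<Longrightarrow> y \<in> I \<Longrightarrow> \<sigma> x \<noteq> y" "x \<in> Q \<Longrightarrow> y \<in> Q \<Longrightarrow> \<sigma> x \<noteq> y"
  "x \<in> Q \<Longrightarrow> y \<in> A \<Longrightarrow> y \<noteq> \<sigma> x" "x \<in> Q \<Longrightarrow> y \<in> I \<Longrightarrow> y \<noteq> \<sigma> x" "x \<in> Q \<Longrightarrow> y \<in> Q \<Longrightarrow> y \<noteq> \<sigma> x"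
  by auto

lemma hub_simps [simp]: "e \<in> A" "z \<in> A" "e \<noteq> z" "z \<noteq> e"
  using hubs by auto

lemma finite_vertices: "finite (vertices \<Gamma>)"
  using finite by (simp add: vertices)

lemma card_vertices: "card (vertices \<Gamma>) = card A + card I + 2 * card Q"
  using finite disjoint inj
  by (simp add: vertices card_Un_disjoint Int_Un_distrib2 card_image)

section \<open>Minimum degree and independence number\<close>

lemma min_degree_eq_1:
  assumes "I \<noteq> {}"
  shows "min_degree \<Gamma> = 1"
  unfolding min_degree_def
proof (rule Min_eqI)
  show "finite (degree \<Gamma> ` vertices \<Gamma>)" using finite_vertices by simp
  fix d assume "d \<in> degree \<Gamma> ` vertices \<Gamma>"
  then obtain v where v: "v \<in> vertices \<Gamma>" "d = degree \<Gamma> v" by blast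
  have "\<exists>w. adjacent \<Gamma> v w"
  proof (cases "v = e")
    case True
    then have "adjacent \<Gamma> v z" by (simp add: adjacent_iff vertices)
    then show ?thesis ..
  next
    case False
    then have "adjacent \<Gamma> v e" using v by (simp add: adjacent_iff vertices)
    then show ?thesis ..
  qed
  then obtain w where w: "adjacent \<Gamma> v w" ..
  then have "{w} \<subseteq> {w \<in> vertices \<Gamma>. adjacent \<Gamma> v w}" by (simp add: adjacent_iff)
  then have "card {w} \<le> d"
    unfolding v degree_def using finite_vertices by (intro card_mono) auto
  then show "1 \<le> d" by simp
next
  obtain x where x: "x \<in> I" using assms by blast
  have "{w \<in> vertices \<Gamma>. adjacent \<Gamma> x w} = {e}"
    using x by (auto simp: adjacent_iff vertices)
  then have "degree \<Gamma> x = 1" by (simp add: degree_def)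
  then show "1 \<in> degree \<Gamma> ` vertices \<Gamma>" using x by (force simp: vertices)
qed

text \<open>An independent set takes at most one vertex from each clique of a cover by
  \<open>card I + card Q + 1\<close> cliques. The hypothesis on \<open>A\<close> provides a vertex
  of \<open>A\<close> other than the hubs, which makes the bound sharp.\<close>

lemma independence_number_eq:
  assumes "A \<noteq> {e, z}"
  shows "independence_number \<Gamma> = card I + card Q + 1"
  unfolding independence_number_def
proof (rule Max_eqI)
  have "{S. independent_set \<Gamma> S} \<subseteq> Pow (vertices \<Gamma>)"
    by (auto simp: independent_set_def)
  then show "finite (card ` {S. independent_set \<Gamma> S})"
    using finite_vertices by (meson finite_Pow_iff finite_imageI finite_subset)
next
  fix k assume "k \<in> card ` {S. independent_set \<Gamma> S}"
  then obtain S where S: "independent_set \<Gamma> S" "k = card S" by blast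
  have sub: "S \<subseteq> A \<union> I \<union> Q \<union> \<sigma> ` Q"
    using S(1) by (simp add: independent_set_def vertices)
  have ind: "\<not> adjacent \<Gamma> u v" if "u \<in> S" "v \<in> S" for u v
    using that S(1) adjacent_iff [of u u] by (cases "u = v") (auto simp: independent_set_def pairwise_def)
  \<comment> \<open>\<open>f\<close> collapses each clique of the clique cover \<open>A\<close>, \<open>{x}\<close>, \<open>{q, \<sigma> q}\<close> to a single vertex.\<close>
  define f where "f v = (if v \<in> A then e else if v \<in> \<sigma> ` Q then inv_into Q \<sigma> v else v)" for v
  have "inj_on f S"
  proof (rule inj_onI, rule ccontr)
    fix u v assume uv: "u \<in> S" "v \<in> S" "f u = f v" "u \<noteq> v"
    then have "\<not> adjacent \<Gamma> u v" using ind by blast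
    then show False
      using uv sub inj inv_into_f_f [OF inj]
      by (auto simp: f_def adjacent_iff vertices split: if_splits)
  qed
  moreover have "f ` S \<subseteq> insert e (I \<union> Q)"
    using sub inj by (auto simp: f_def)
  ultimately have "card S \<le> card (insert e (I \<union> Q))"
    using finite by (metis card_inj_on_le finite_Un finite_insert)
  also have "\<dots> = card I + card Q + 1"
    using finite disjoint hubs by (subst card_insert_disjoint) (auto simp: card_Un_disjoint)
  finally show "k \<le> card I + card Q + 1" using S by simp
next
  \<comment> \<open>\<open>x\<close> represents \<open>A\<close>; the hubs are avoided because
    \<open>e\<close> is adjacent to everything and \<open>z\<close> to all of
    \<open>Q\<close>.\<close>
  obtain x where x: "x \<in> A" "x \<noteq> e" "x \<noteq> z" using assms hubs by blast
  let ?S = "insert x (I \<union> Q)"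
  have "\<not> adjacent \<Gamma> u v" if "u \<in> ?S" "v \<in> ?S" "u \<noteq> v" for u v
  proof -
    have *: "w \<noteq> e" "w \<noteq> z" "w \<in> A \<longleftrightarrow> w = x" "w \<notin> \<sigma> ` Q" if "w \<in> ?S" for w
      using that x disjoint hubs by blast+
    show ?thesis
      using * [OF that(1)] * [OF that(2)] \<open>u \<noteq> v\<close> unfolding adjacent_iff by blast
  qed
  then have "independent_set \<Gamma> ?S"
    using x by (auto simp: independent_set_def pairwise_def vertices)
  moreover have "card ?S = card I + card Q + 1"
    using finite disjoint x by (subst card_insert_disjoint) (auto simp: card_Un_disjoint)
  ultimately show "card I + card Q + 1 \<in> card ` {S. independent_set \<Gamma> S}"
    by (metis imageI mem_Collect_eq)
qed

section \<open>Matching number\<close>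

lemma edge_cases:
  assumes "E \<in> edges \<Gamma>"
  obtains u v where "E = {u, v}" "adjacent \<Gamma> u v"
  using assms edge_is_pair [OF assms] by (metis adjacent_def)

text \<open>Only edges from \<open>e\<close> into \<open>I\<close> fail to have both ends in
  \<open>?W\<close>, and a matching has at most one edge at \<open>e\<close>. Hence
  \<open>2 * card M \<le> card ?W + 1\<close>, and since \<open>card ?W\<close> is even, the excess
  1 disappears on halving. Equality comes from a perfect matching of \<open>A\<close> together with
  the pairs \<open>{q, \<sigma> q}\<close>.\<close>

lemma matching_number_eq:
  assumes "card A = 2 * m"
  shows "matching_number \<Gamma> = m + card Q"
  unfolding matching_number_def
proof (rule Max_eqI)
  have "edges \<Gamma> \<subseteq> Pow (vertices \<Gamma>)"
    by (auto elim!: edge_cases simp: adjacent_iff)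
  then have fin_edges: "finite (edges \<Gamma>)" using finite_vertices by (meson finite_Pow_iff finite_subset)
  have "{M. matching \<Gamma> M} \<subseteq> Pow (edges \<Gamma>)"
    by (auto simp: matching_def)
  then show "finite (card ` {M. matching \<Gamma> M})"
    using fin_edges by (meson finite_Pow_iff finite_imageI finite_subset)
  fix k assume "k \<in> card ` {M. matching \<Gamma> M}"
  then obtain M where M: "M \<subseteq> edges \<Gamma>" "pairwise disjnt M" "k = card M"
    by (auto simp: matching_def)
  let ?W = "A \<union> Q \<union> \<sigma> ` Q"
  have finM: "finite M" using M fin_edges finite_subset by blast
  have finW: "finite ?W" using finite by simp
  \<comment> \<open>The extra 1 compensates for an edge from \<open>e\<close> into \<open>I\<close>,
    which has a single end in \<open>?W\<close>.\<close>
  have "card (E \<inter> ?W) + (if e \<in> E then 1 else 0) \<ge> 2" if E: "E \<in> M" for E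
  proof -
    obtain u v where uv: "E = {u, v}" "adjacent \<Gamma> u v"
      using edge_cases E M(1) by blast
    show ?thesis
    proof (cases "u \<in> ?W \<and> v \<in> ?W")
      case True
      then have "E \<inter> ?W = {u, v}" using uv by auto
      then show ?thesis using uv by (simp add: adjacent_iff)
    next
      case False
      then have "e \<in> E" using uv by (auto simp: adjacent_iff vertices)
      moreover have "card {e} \<le> card (E \<inter> ?W)"
        using \<open>e \<in> E\<close> finW by (intro card_mono) auto
      ultimately show ?thesis by simp
    qed
  qed
  then have "2 * card M \<le> (\<Sum>E\<in>M. card (E \<inter> ?W) + (if e \<in> E then 1 else 0))"
    using sum_bounded_below [of M 2 "\<lambda>E. card (E \<inter> ?W) + (if e \<in> E then 1 else 0)"] by simp
  also have "\<dots> = (\<Sum>E\<in>M. card (E \<inter> ?W)) + card {E \<in> M. e \<in> E}"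
    using finM by (simp add: sum.distrib sum.If_cases Int_def)
  also have "(\<Sum>E\<in>M. card (E \<inter> ?W)) = card (\<Union>E\<in>M. E \<inter> ?W)"
    using M(2) finM finW
    by (intro card_UN_disjoint [symmetric]) (auto simp: pairwise_def disjnt_def)
  also have "\<dots> \<le> card ?W" using finW by (intro card_mono) auto
  also have "card ?W = 2 * m + 2 * card Q"
    using finite disjoint inj assms by (simp add: card_Un_disjoint Int_Un_distrib2 card_image)
  also have "card {E \<in> M. e \<in> E} \<le> 1"
    using M(2) finM
    by (subst One_nat_def, subst card_le_Suc0_iff_eq) (auto simp: pairwise_def disjnt_def)
  finally show "k \<le> m + card Q" using M(3) by simp
next
  obtain N where N: "card N = m" "finite N" "pairwise disjnt N"
      "\<forall>E\<in>N. \<exists>u\<in>A. \<exists>v\<in>A. u \<noteq> v \<and> E = {u, v}"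
    using perfect_matching_exists [OF finite(1) assms] by blast
  let ?P = "(\<lambda>q. {q, \<sigma> q}) ` Q"
  have edgeI: "{u, v} \<in> edges \<Gamma>" if "adjacent \<Gamma> u v" for u v
    using that by (simp add: adjacent_def)
  have NA: "E \<subseteq> A" if "E \<in> N" for E using N(4) that by fastforce
  have "N \<subseteq> edges \<Gamma>"
    using N(4) by (auto intro!: edgeI simp: adjacent_iff vertices)
  moreover have "?P \<subseteq> edges \<Gamma>"
    by (auto intro!: edgeI simp: adjacent_iff vertices)
  moreover have PA: "disjnt E F" if "E \<in> N" "F \<in> ?P" for E F
    using NA [OF that(1)] that(2) by (auto simp: disjnt_def)
  moreover have "pairwise disjnt ?P"
    using inj by (auto simp: pairwise_def disjnt_def inj_on_def)
  ultimately have match: "matching \<Gamma> (N \<union> ?P)"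
    using N(3) unfolding matching_def pairwise_def by (metis Un_iff Un_least disjnt_sym)
  have card: "card (N \<union> ?P) = m + card Q"
  proof -
    have "inj_on (\<lambda>q. {q, \<sigma> q}) Q"
      by (fastforce simp: inj_on_def doubleton_eq_iff)
    moreover have "N \<inter> ?P = {}" using NA disjoint by fastforce
    ultimately show ?thesis using N finite by (simp add: card_Un_disjoint card_image)
  qed
  show "m + card Q \<in> card ` {M. matching \<Gamma> M}"
    unfolding card [symmetric] using match by blast
qed

section \<open>Shortest paths and strong metric dimension\<close>

lemma adjacent_sym: "adjacent \<Gamma> u v \<Longrightarrow> adjacent \<Gamma> v u"
  by (simp add: adjacent_def insert_commute)

lemma e_adjacent: "v \<in> vertices \<Gamma> \<Longrightarrow> v \<noteq> e \<Longrightarrow> adjacent \<Gamma> e v"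
  by (simp add: adjacent_iff vertices)

text \<open>The detour through \<open>e\<close> bounds every distance by 2, so a shortest path with
  interior vertex \<open>v\<close> must be \<open>[s, v, t]\<close>. This turns strong resolution
  into a statement about adjacency.\<close>

lemma shortest_path_through_iff:
  assumes "v \<noteq> s" "v \<noteq> t"
  shows "(\<exists>p. shortest_path \<Gamma> s p t \<and> v \<in> set p) \<longleftrightarrow>
    s \<noteq> t \<and> \<not> adjacent \<Gamma> s t \<and> adjacent \<Gamma> s v \<and> adjacent \<Gamma> v t"
proof
  assume "\<exists>p. shortest_path \<Gamma> s p t \<and> v \<in> set p"
  then obtain p where p: "path_between \<Gamma> s p t" "v \<in> set p"
    and min: "\<And>q. path_between \<Gamma> s q t \<Longrightarrow> length p \<le> length q"
    by (auto simp: shortest_path_def)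
  have ends: "s \<in> vertices \<Gamma>" "t \<in> vertices \<Gamma>"
    using p(1) hd_in_set last_in_set by (fastforce simp: path_between_def)+
  have "s \<noteq> t"
  proof
    assume "s = t"
    then have "path_between \<Gamma> s [s] t" using ends by (simp add: path_between_def)
    then have "length p \<le> 1" using min by fastforce
    then show False using p assms
      by (cases p) (auto simp: path_between_def)
  qed
  \<comment> \<open>\<open>length\<close> counts vertices, so distance 2 means length 3; the
    competitor is \<open>[s, t]\<close> if an end is \<open>e\<close>, and \<open>[s, e, t]\<close>
    otherwise.\<close>
  have "length p \<le> 3"
  proof (cases "s = e \<or> t = e")
    case True
    then have "adjacent \<Gamma> s t" using e_adjacent ends \<open>s \<noteq> t\<close> adjacent_sym by metis
    then have "path_between \<Gamma> s [s, t] t" using ends \<open>s \<noteq> t\<close> by (simp add: path_between_def)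
    then show ?thesis using min by fastforce
  next
    case False
    then have "path_between \<Gamma> s [s, e, t] t"
      using ends \<open>s \<noteq> t\<close> e_adjacent adjacent_sym
      by (auto simp: path_between_def vertices hubs)
    then show ?thesis using min by fastforce
  qed
  then have "length p = 0 \<or> length p = 1 \<or> length p = 2 \<or> length p = 3" by linarith
  then have p3: "p = [s, v, t]"
    using p \<open>s \<noteq> t\<close> assms
    by (auto simp: path_between_def length_Suc_conv eval_nat_numeral split: if_splits)
  have "\<not> adjacent \<Gamma> s t"
  proof
    assume "adjacent \<Gamma> s t"
    then have "path_between \<Gamma> s [s, t] t" using ends \<open>s \<noteq> t\<close> by (simp add: path_between_def)
    from min [OF this] show False by (simp add: p3)
  qed
  then show "s \<noteq> t \<and> \<not> adjacent \<Gamma> s t \<and> adjacent \<Gamma> s v \<and> adjacent \<Gamma> v t"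
    using p(1) \<open>s \<noteq> t\<close> by (simp add: p3 path_between_def)
next
  assume R: "s \<noteq> t \<and> \<not> adjacent \<Gamma> s t \<and> adjacent \<Gamma> s v \<and> adjacent \<Gamma> v t"
  then have "path_between \<Gamma> s [s, v, t] t"
    using assms by (auto simp: path_between_def adjacent_iff)
  moreover have "3 \<le> length q" if "path_between \<Gamma> s q t" for q
  proof (rule ccontr)
    assume "\<not> 3 \<le> length q"
    then have "length q = 0 \<or> length q = 1 \<or> length q = 2" by linarith
    then show False using that R
      by (auto simp: path_between_def length_Suc_conv eval_nat_numeral)
  qed
  ultimately have "shortest_path \<Gamma> s [s, v, t] t"
    by (simp add: shortest_path_def eval_nat_numeral)
  then show "\<exists>p. shortest_path \<Gamma> s p t \<and> v \<in> set p" by force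
qed

lemma strongly_resolves_through:
  assumes "s \<noteq> t" "\<not> adjacent \<Gamma> s t" "adjacent \<Gamma> s v" "adjacent \<Gamma> v t"
  shows "strongly_resolves \<Gamma> s t v"
proof -
  have "v \<noteq> s" "v \<noteq> t" using assms(3,4) by (auto simp: adjacent_iff)
  then show ?thesis
    unfolding strongly_resolves_def using shortest_path_through_iff assms by blast
qed

text \<open>Paths exist because \<open>e\<close> is joined to all other vertices, and a shortest
  path contains its own start. Hence a candidate set only has to be checked on pairs outside
  it.\<close>

lemma strongly_resolves_end:
  assumes "u \<in> vertices \<Gamma>" "v \<in> vertices \<Gamma>" "u \<noteq> v"
  shows "strongly_resolves \<Gamma> u u v" "strongly_resolves \<Gamma> v u v"
proof -
  have *: "\<exists>p. shortest_path \<Gamma> s p t" if st: "s \<in> vertices \<Gamma>" "t \<in> vertices \<Gamma>" "s \<noteq> t" for s t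
  proof -
    have "\<exists>p. path_between \<Gamma> s p t"
    proof (cases "s = e \<or> t = e")
      case True
      then have "path_between \<Gamma> s [s, t] t"
        using st e_adjacent adjacent_sym by (auto simp: path_between_def)
      then show ?thesis ..
    next
      case False
      then have "path_between \<Gamma> s [s, e, t] t"
        using st e_adjacent adjacent_sym by (auto simp: path_between_def vertices )
      then show ?thesis ..
    qed
    then have "shortest_path \<Gamma> s (ARG_MIN length p. path_between \<Gamma> s p t) t"
      unfolding shortest_path_def
      by (metis arg_min_nat_lemma)
    then show ?thesis ..
  qed
  have hd: "s \<in> set p" if "shortest_path \<Gamma> s p t" for s p t
    using that hd_in_set by (fastforce simp: shortest_path_def path_between_def)
  show "strongly_resolves \<Gamma> u u v" "strongly_resolves \<Gamma> v u v"
    unfolding strongly_resolves_def using * assms hd by metis+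
qed

text \<open>Two adjacent vertices other than the hubs both lie in \<open>A\<close> or form a pair
  \<open>{q, \<sigma> q}\<close>. Either way they have the same closed neighbourhood, so no third
  vertex is adjacent to just one of them.\<close>

lemma adjacent_twin:
  assumes "u \<notin> {e, z}" "v \<notin> {e, z}" "adjacent \<Gamma> u v" "adjacent \<Gamma> w v" "w \<noteq> u"
  shows "adjacent \<Gamma> w u"
proof -
  have w: "w = e \<or> w \<in> A \<and> v \<in> A \<or> w = z \<and> v \<in> Q \<union> \<sigma> ` Q \<or> w \<in> Q \<and> v = \<sigma> w \<or> v \<in> Q \<and> w = \<sigma> v"
    and V: "u \<in> vertices \<Gamma>" "w \<in> vertices \<Gamma>"
    using assms by (simp_all add: adjacent_iff)
  consider "u \<in> A" "v \<in> A" | "u \<in> Q" "v = \<sigma> u" | "v \<in> Q" "u = \<sigma> v"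
    using assms by (auto simp: adjacent_iff)
  then show ?thesis
  proof cases
    case 1
    then have "w \<in> A" using w by auto
    then show ?thesis using 1 V assms(5) by (simp add: adjacent_iff)
  next
    case 2
    then have "w = e \<or> w = z" using w assms(5) by auto
    then show ?thesis using 2 V assms(5) by (auto simp: adjacent_iff)
  next
    case 3
    then have "w = e \<or> w = z" using w assms(5) by auto
    then show ?thesis using 3 V assms(5) by (auto simp: adjacent_iff)
  qed
qed

lemma strong_metric_dimension_eq:
  assumes "A \<noteq> {e, z}" "I \<noteq> {}" "Q \<noteq> {}"
  shows "strong_metric_dimension \<Gamma> = card (vertices \<Gamma>) - 3"
  unfolding strong_metric_dimension_def
proof (rule Min_eqI)
  have "{U. strong_resolving_set \<Gamma> U} \<subseteq> Pow (vertices \<Gamma>)"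
    by (auto simp: strong_resolving_set_def)
  then show "finite (card ` {U. strong_resolving_set \<Gamma> U})"
    using finite_vertices by (meson finite_Pow_iff finite_imageI finite_subset)
next
  fix k assume "k \<in> card ` {U. strong_resolving_set \<Gamma> U}"
  then obtain U where U: "strong_resolving_set \<Gamma> U" "k = card U" by blast
  have UV: "U \<subseteq> vertices \<Gamma>" using U by (simp add: strong_resolving_set_def)
  have "u = v" if uv: "u \<in> vertices \<Gamma> - U - {e, z}" "v \<in> vertices \<Gamma> - U - {e, z}" for u v
  proof (rule ccontr)
    assume "u \<noteq> v"
    then obtain w where w: "w \<in> U" "strongly_resolves \<Gamma> w u v"
      using U(1) uv unfolding strong_resolving_set_def by blast
    then have "w \<noteq> u" "w \<noteq> v" using that by auto
    \<comment> \<open>\<open>w\<close> differs from \<open>u\<close> and \<open>v\<close>, so it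
      resolves them by a path of three vertices with \<open>u\<close> or \<open>v\<close> in the
      middle; thus it is adjacent to exactly one of two adjacent vertices.\<close>
    then have "(\<not> adjacent \<Gamma> w u \<and> adjacent \<Gamma> w v \<or> \<not> adjacent \<Gamma> w v \<and> adjacent \<Gamma> w u) \<and> adjacent \<Gamma> u v"
      using w(2) \<open>u \<noteq> v\<close> shortest_path_through_iff [of v w u] shortest_path_through_iff [of u w v] adjacent_sym
      unfolding strongly_resolves_def by metis
    then show False
      using adjacent_twin [of u v w] adjacent_twin [of v u w] adjacent_sym \<open>w \<noteq> u\<close> \<open>w \<noteq> v\<close> uv
      by blast
  qed
  then have "card (vertices \<Gamma> - U - {e, z}) \<le> 1"
    by (metis One_nat_def card_le_Suc0_iff_eq finite_Diff finite_vertices)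
  \<comment> \<open>Taking out the hubs removes at most two vertices, so the complement of
    \<open>U\<close> has at most three.\<close>
  moreover have "card (vertices \<Gamma> - U) - card {e, z} \<le> card (vertices \<Gamma> - U - {e, z})"
    by (rule diff_card_le_card_Diff) simp
  moreover have "card (vertices \<Gamma> - U) = card (vertices \<Gamma>) - card U"
    using UV finite_vertices by (meson card_Diff_subset finite_subset)
  ultimately show "card (vertices \<Gamma>) - 3 \<le> k" using hubs(3) U(2) by simp
next
  obtain x where x: "x \<in> A" "x \<noteq> e" "x \<noteq> z" using assms hubs by blast
  obtain y where y: "y \<in> I" using assms by blast
  obtain q where q: "q \<in> Q" using assms by blast
  let ?C = "{e, z, x}"
  let ?U = "vertices \<Gamma> - ?C"
  have ne: "y \<notin> A" "q \<notin> A" "y \<notin> {e, z, x}" "q \<notin> {e, z, x}" "x \<notin> Q \<union> \<sigma> ` Q" "y \<notin> Q \<union> \<sigma> ` Q"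
    using x y q disjoint hubs by blast+
  then have yq: "y \<in> ?U" "q \<in> ?U"
    using y q by (auto simp: vertices)
  have sym: "strongly_resolves \<Gamma> w u v \<longleftrightarrow> strongly_resolves \<Gamma> w v u" for w u v
    by (auto simp: strongly_resolves_def)
  have V: "{e, z, x, y, q} \<subseteq> vertices \<Gamma>" using x y q hubs by (simp add: vertices)
  \<comment> \<open>Only pairs inside \<open>?C\<close> are critical. The pendant \<open>y\<close>
    reaches \<open>z\<close> and \<open>x\<close> through \<open>e\<close> and so resolves
    \<open>e\<close> from both; \<open>q\<close> reaches \<open>x\<close> through \<open>z\<close>
    and resolves these two.\<close>
  have "adjacent \<Gamma> e z" "adjacent \<Gamma> e x" "adjacent \<Gamma> z x" "adjacent \<Gamma> y e" "adjacent \<Gamma> q z"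
    using x q ne V by (auto simp: adjacent_iff)
  moreover have "\<not> adjacent \<Gamma> y z" "\<not> adjacent \<Gamma> y x" "\<not> adjacent \<Gamma> q x"
    using x y ne hubs disjoint unfolding adjacent_iff by blast+
  ultimately have "strongly_resolves \<Gamma> y z e" "strongly_resolves \<Gamma> y x e" "strongly_resolves \<Gamma> q x z"
    using ne by (auto intro: strongly_resolves_through)
  then have C: "\<exists>w\<in>?U. strongly_resolves \<Gamma> w u v" if "u \<in> ?C" "v \<in> ?C" "u \<noteq> v" for u v
    using that yq sym by blast
  have "strong_resolving_set \<Gamma> ?U"
    unfolding strong_resolving_set_def
  proof (intro conjI ballI impI)
    fix u v assume uv: "u \<in> vertices \<Gamma>" "v \<in> vertices \<Gamma>" "u \<noteq> v"
    show "\<exists>w\<in>?U. strongly_resolves \<Gamma> w u v"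
      using C [of u v] strongly_resolves_end [OF uv] uv by blast
  qed simp
  moreover have "card ?U = card (vertices \<Gamma>) - 3"
    using x by (subst card_Diff_subset) (auto simp: vertices)
  ultimately show "card (vertices \<Gamma>) - 3 \<in> card ` {U. strong_resolving_set \<Gamma> U}"
    by (metis imageI mem_Collect_eq)
qed

end

section \<open>Cyclic subgroups of the semidihedral group\<close>

text \<open>In a finite group, natural exponents already exhaust a cyclic subgroup. This replaces
  subgroups by a common generator in the adjacency relation.\<close>

lemma (in group) common_cyclic_subgroup_iff:
  assumes "finite (carrier G)" "x \<in> carrier G" "y \<in> carrier G"
  shows "(\<exists>H. subgroup H G \<and> cyclic_group (G\<lparr>carrier := H\<rparr>) \<and> x \<in> H \<and> y \<in> H) \<longleftrightarrow>
    (\<exists>g\<in>carrier G. \<exists>(j::nat) (k::nat). x = g [^] j \<and> y = g [^] k)" (is "?L \<longleftrightarrow> ?R")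
proof
  assume ?L
  then obtain H where H: "subgroup H G" "cyclic_group (G\<lparr>carrier := H\<rparr>)" "x \<in> H" "y \<in> H"
    by blast
  interpret K: group "G\<lparr>carrier := H\<rparr>"
    using H(1) by (rule subgroup_imp_group)
  from H(2) obtain g where g: "g \<in> H" "H = range (\<lambda>n::int. g [^]\<^bsub>G\<lparr>carrier := H\<rparr>\<^esub> n)"
    by (auto simp: K.cyclic_group)
  have gG: "g \<in> carrier G" using g(1) H(1) subgroup.mem_carrier by metis
  \<comment> \<open>Powers taken in the subgroup agree with those in \<open>G\<close>; finiteness
    then trades integer for natural exponents.\<close>
  have "H = range (\<lambda>n::int. g [^] n)"
    using g int_pow_consistent [OF H(1) g(1)] by auto
  also have "\<dots> = generate G {g}"
    using generate_pow [OF gG] by auto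
  also have "\<dots> = {g [^] k |k. k \<in> (UNIV::nat set)}"
    using generate_pow_on_finite_carrier [OF assms(1) gG] by simp
  finally show ?R using H gG by blast
next
  assume ?R
  then obtain g and j k :: nat where g: "g \<in> carrier G" "x = g [^] j" "y = g [^] k" by blast
  let ?H = "generate G {g}"
  have "subgroup ?H G" using g by (intro generate_is_subgroup) simp
  moreover have "cyclic_group (G\<lparr>carrier := ?H\<rparr>)"
    using cyclic_group_generated [of g] g by (simp add: subgroup_generated_def)
  moreover have "g [^] i \<in> ?H" for i :: nat
    using generate_pow_on_finite_carrier [OF assms(1) g(1)] by auto
  ultimately show ?L using g by blast
qed

lemma adjacent_enhanced_power_graph:
  fixes G :: "'a monoid" (structure)
  assumes "group G" "finite (carrier G)"
  shows "adjacent (enhanced_power_graph G) x y \<longleftrightarrow>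
    x \<in> carrier G \<and> y \<in> carrier G \<and> x \<noteq> y \<and>
    (\<exists>g\<in>carrier G. \<exists>(j::nat) (k::nat). x = g [^] j \<and> y = g [^] k)"
proof -
  have "adjacent (enhanced_power_graph G) x y \<longleftrightarrow>
    x \<in> carrier G \<and> y \<in> carrier G \<and> x \<noteq> y \<and>
    (\<exists>H. subgroup H G \<and> cyclic_group (G\<lparr>carrier := H\<rparr>) \<and> x \<in> H \<and> y \<in> H)"
    unfolding adjacent_def enhanced_power_graph_def
    by (simp add: doubleton_eq_iff) blast
  then show ?thesis using group.common_cyclic_subgroup_iff [OF assms] by blast
qed

text \<open>The defining relations alone suffice to bring words into normal form; that different
  normal forms stay distinct is added in \<open>semidihedral_group\<close>.\<close>

locale semidihedral_relations = group G for G :: "'a monoid" (structure) +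
  fixes a b and n :: nat
  assumes n_pos: "n \<ge> 1"
    and a_closed [simp]: "a \<in> carrier G" and b_closed [simp]: "b \<in> carrier G"
    and a_pow: "a [^] (4 * n) = \<one>"
    and b_square: "b \<otimes> b = \<one>"
    and b_a: "b \<otimes> a = a [^] (2 * n - 1) \<otimes> b"

begin

lemma b_a_pow: "b \<otimes> a [^] k = a [^] ((2 * n - 1) * k) \<otimes> b" for k :: nat
proof (induction k)
  case (Suc k)
  have "b \<otimes> a [^] Suc k = (b \<otimes> a [^] k) \<otimes> a" by (simp add: nat_pow_Suc m_assoc)
  also have "\<dots> = a [^] ((2 * n - 1) * k) \<otimes> (b \<otimes> a)" by (simp add: Suc m_assoc)
  also have "\<dots> = a [^] ((2 * n - 1) * k) \<otimes> a [^] (2 * n - 1) \<otimes> b" by (simp add: b_a m_assoc)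
  also have "\<dots> = a [^] ((2 * n - 1) * Suc k) \<otimes> b" by (simp add: nat_pow_mult add.commute)
  finally show ?case .
qed simp

lemma inv_a: "inv a = a [^] (4 * n - 1)"
proof (rule inv_equality)
  have "a [^] (4 * n - 1) \<otimes> a = a [^] Suc (4 * n - 1)" by (simp only: nat_pow_Suc)
  then show "a [^] (4 * n - 1) \<otimes> a = \<one>" using n_pos a_pow by simp
qed simp_all

lemma inv_b: "inv b = b"
  using b_square by (simp add: inv_equality)

text \<open>Exponents are left unreduced, so closure under products needs no arithmetic modulo
  \<open>4 * n\<close>.\<close>

definition normal_forms where
  "normal_forms = range (\<lambda>i::nat. a [^] i) \<union> range (\<lambda>i::nat. a [^] i \<otimes> b)"

lemma one_normal_form: "\<one> \<in> normal_forms"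
  unfolding normal_forms_def by (metis UnI1 nat_pow_0 rangeI)

lemma a_pow_mult_normal_form: "a [^] k \<otimes> x \<in> normal_forms" if "x \<in> normal_forms" for k :: nat
  using that by (auto simp: normal_forms_def m_assoc [symmetric] nat_pow_mult simp del: right_cancel)

text \<open>Closure under left multiplication by powers of \<open>a\<close> and by \<open>b\<close>
  is what an induction over words uses.\<close>

lemma b_mult_normal_form:
  assumes "x \<in> normal_forms"
  shows "b \<otimes> x \<in> normal_forms"
proof -
  have "b \<otimes> (a [^] i \<otimes> b) = a [^] ((2 * n - 1) * i)" for i :: nat
  proof -
    have "b \<otimes> (a [^] i \<otimes> b) = b \<otimes> a [^] i \<otimes> b" by (simp add: m_assoc)
    also have "\<dots> = a [^] ((2 * n - 1) * i)" by (simp add: b_a_pow m_assoc b_square)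
    finally show ?thesis .
  qed
  then show ?thesis using assms b_a_pow unfolding normal_forms_def by auto
qed

end

locale semidihedral_group = semidihedral_relations +
  assumes elements: "x \<in> carrier G \<Longrightarrow> (\<exists>i. x = a [^] (i::nat)) \<or> (\<exists>i. x = a [^] (i::nat) \<otimes> b)"
    and a_pow_inj: "a [^] (i::nat) = a [^] (j::nat) \<Longrightarrow> i mod (4 * n) = j mod (4 * n)"
    and a_pow_not_b: "a [^] (i::nat) \<noteq> a [^] (j::nat) \<otimes> b"
begin

section \<open>Equality of normal forms and powers of the elements outside the powers of
  \<open>a\<close>\<close>

lemma a_pow_eq_iff: "a [^] i = a [^] j \<longleftrightarrow> i mod (4 * n) = j mod (4 * n)" for i j :: nat
proof
  have *: "a [^] i = a [^] (i mod (4 * n))" for i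
  proof -
    have "a [^] (4 * n * (i div (4 * n)) + i mod (4 * n)) = a [^] (i mod (4 * n))"
      by (simp only: nat_pow_mult [symmetric] nat_pow_pow [symmetric] a_closed a_pow) simp
    then show ?thesis by simp
  qed
  show "a [^] i = a [^] j" if "i mod (4 * n) = j mod (4 * n)"
    using * [of i] * [of j] that by simp
qed (rule a_pow_inj)

lemma a_pow_b_eq_iff: "a [^] i \<otimes> b = a [^] j \<otimes> b \<longleftrightarrow> i mod (4 * n) = j mod (4 * n)" for i j :: nat
  by (simp add: a_pow_eq_iff)

lemma a_pow_eq_one: "a [^] i = \<one>" if "4 * n dvd i" for i :: nat
  using that a_pow_eq_iff [of i 0] by (simp add: dvd_eq_mod_eq_0)

text \<open>Moving the inner \<open>b\<close> to the right multiplies the second exponent by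
  \<open>2 * n - 1\<close>, and the exponents add up to \<open>2 * n * i\<close>. Modulo
  \<open>4 * n\<close> this depends only on the parity of \<open>i\<close>, which separates order 2
  from order 4.\<close>

lemma square_a_pow_b: "(a [^] i \<otimes> b) [^] (2::nat) = a [^] (2 * n * i)" for i :: nat
proof -
  have "(a [^] i \<otimes> b) [^] (2::nat) = a [^] i \<otimes> (b \<otimes> a [^] i) \<otimes> b"
    by (simp add: numeral_2_eq_2 m_assoc)
  also have "\<dots> = a [^] i \<otimes> a [^] ((2 * n - 1) * i) \<otimes> (b \<otimes> b)"
    by (simp add: b_a_pow m_assoc)
  also have "\<dots> = a [^] (i + (2 * n - 1) * i)" by (simp add: b_square nat_pow_mult)
  also have "i + (2 * n - 1) * i = 2 * n * i" using n_pos by (cases n) (simp_all add: algebra_simps)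
  finally show ?thesis .
qed

text \<open>The only involution among the powers of \<open>a\<close>; besides the identity, it is
  the second hub of the graph.\<close>

definition half_turn where "half_turn = a [^] (2 * n)"

lemma half_turn_closed [simp]: "half_turn \<in> carrier G"
  by (simp add: half_turn_def)

lemma half_turn_square: "half_turn [^] (2::nat) = \<one>"
  by (simp add: half_turn_def nat_pow_pow a_pow_eq_one)

lemma square_even: "(a [^] i \<otimes> b) [^] (2::nat) = \<one>" if "even i" for i :: nat
  using that by (auto simp: square_a_pow_b intro!: a_pow_eq_one)

lemma square_odd: "(a [^] i \<otimes> b) [^] (2::nat) = half_turn" if "odd i" for i :: nat
proof -
  obtain k where "i = 2 * k + 1" using \<open>odd i\<close> by (auto elim: oddE)
  then have "2 * n * i = 2 * n + 4 * n * k" by (simp add: algebra_simps)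
  then show ?thesis by (simp only: square_a_pow_b half_turn_def a_pow_eq_iff mod_mult_self2)
qed

lemma pow_even_cases:
  fixes i :: nat
  assumes "even i"
  shows "(a [^] i \<otimes> b) [^] (k::nat) \<in> {\<one>, a [^] i \<otimes> b}"
proof -
  have "(a [^] i \<otimes> b) [^] (2 * (k div 2) + k mod 2) = (a [^] i \<otimes> b) [^] (k mod 2)"
    using square_even [OF assms]
    by (simp only: nat_pow_mult [symmetric] nat_pow_pow [symmetric] m_closed nat_pow_closed a_closed b_closed) simp
  moreover have "k mod 2 = 0 \<or> k mod 2 = 1" by linarith
  ultimately show ?thesis by auto
qed

text \<open>The square of \<open>a [^] i \<otimes> b\<close> is \<open>half_turn\<close>, whose
  square is \<open>\<one>\<close>. So the two lowest binary digits of \<open>k\<close> decide the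
  value: the last one selects the factor \<open>a [^] i \<otimes> b\<close>, the other one
  \<open>half_turn\<close>.\<close>

lemma pow_odd_cases:
  fixes i :: nat
  assumes "odd i"
  shows "(a [^] i \<otimes> b) [^] (k::nat) \<in> {\<one>, half_turn, a [^] i \<otimes> b, half_turn \<otimes> (a [^] i \<otimes> b)}"
proof -
  have "(a [^] i \<otimes> b) [^] (2 * (k div 2) + k mod 2) = half_turn [^] (k div 2) \<otimes> (a [^] i \<otimes> b) [^] (k mod 2)"
    using square_odd [OF assms]
    by (simp only: nat_pow_mult [symmetric] nat_pow_pow [symmetric] m_closed nat_pow_closed a_closed b_closed)
  moreover have "half_turn [^] (2 * (k div 2 div 2) + k div 2 mod 2) = half_turn [^] (k div 2 mod 2)"
    using half_turn_square
    by (simp only: nat_pow_mult [symmetric] nat_pow_pow [symmetric] half_turn_closed) simp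
  moreover have "k mod 2 = 0 \<or> k mod 2 = 1" "k div 2 mod 2 = 0 \<or> k div 2 mod 2 = 1" by linarith+
  ultimately show ?thesis by auto
qed

section \<open>Partition of the group into the parts of the rosette\<close>

definition "rotations = (\<lambda>i. a [^] i) ` {..<4 * n}"
text \<open>The involutions outside the powers of \<open>a\<close>; \<open>half_turn\<close> is
  counted among the \<open>rotations\<close>.\<close>

definition "involutions = (\<lambda>i. a [^] (2 * i) \<otimes> b) ` {..<2 * n}"
text \<open>One of each pair of mutually inverse elements \<open>g\<close>,
  \<open>half_turn \<otimes> g\<close> of order 4 outside the powers of \<open>a\<close>.
  Multiplication by \<open>half_turn\<close> shifts the exponent by \<open>2 * n\<close>, so
  exponents below \<open>2 * n\<close> represent all pairs.\<close>

definition "quarters = (\<lambda>i. a [^] (2 * i + 1) \<otimes> b) ` {..<n}"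

lemma half_turn_mult: "half_turn \<otimes> (a [^] i \<otimes> b) = a [^] (2 * n + i) \<otimes> b" for i :: nat
  by (simp add: half_turn_def m_assoc [symmetric] nat_pow_mult)

lemma half_turn_quarters:
  "(\<otimes>) half_turn ` quarters = (\<lambda>i. a [^] (2 * n + 2 * i + 1) \<otimes> b) ` {..<n}"
  by (simp only: quarters_def image_image half_turn_mult add.assoc)

lemma a_pow_in_rotations [simp]: "a [^] i \<in> rotations" for i :: nat
proof -
  have "a [^] i = a [^] (i mod (4 * n))" by (simp add: a_pow_eq_iff)
  then show ?thesis using n_pos by (auto simp: rotations_def)
qed

lemma even_in_involutions: "a [^] i \<otimes> b \<in> involutions" if "even i" for i :: nat
proof -
  obtain k where k: "i = 2 * k" using \<open>even i\<close> by blast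
  have eq: "2 * (k mod (2 * n)) = i mod (4 * n)"
    using mod_mult_mult1 [of 2 k "2 * n"] by (simp add: k)
  have "a [^] i \<otimes> b = a [^] (2 * (k mod (2 * n))) \<otimes> b"
    unfolding a_pow_b_eq_iff eq by simp
  then show ?thesis using n_pos by (auto simp: involutions_def)
qed

lemma odd_in_quarters: "a [^] i \<otimes> b \<in> quarters \<union> (\<otimes>) half_turn ` quarters" if "odd i" for i :: nat
proof -
  let ?k = "i mod (4 * n) div 2"
  \<comment> \<open>\<open>4 * n\<close> is even, so reduction keeps the parity of the
    exponent.\<close>
  have "odd (i mod (4 * n))" using that by (simp add: odd_iff_mod_2_eq_one mod_mod_cancel)
  then have k: "i mod (4 * n) = 2 * ?k + 1" by simp
  have "i mod (4 * n) < 4 * n" using n_pos by simp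
  then have k2: "?k < 2 * n" by linarith
  have eq: "a [^] i \<otimes> b = a [^] (2 * ?k + 1) \<otimes> b"
    unfolding a_pow_b_eq_iff k [symmetric] by simp
  show ?thesis
  proof (cases "?k < n")
    case True
    then show ?thesis using eq by (auto simp: quarters_def)
  next
    case False
    then have "2 * ?k + 1 = 2 * n + 2 * (?k - n) + 1" "?k - n < n" using k2 by auto
    then show ?thesis unfolding half_turn_quarters using eq by auto
  qed
qed

lemma element_cases:
  assumes "x \<in> carrier G"
  obtains i :: nat where "x = a [^] i" | i :: nat where "even i" "x = a [^] i \<otimes> b"
    | i :: nat where "odd i" "x = a [^] i \<otimes> b"
  using elements [OF assms] by blast

lemma carrier_eq: "carrier G = rotations \<union> involutions \<union> quarters \<union> (\<otimes>) half_turn ` quarters"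
proof
  show "carrier G \<subseteq> rotations \<union> involutions \<union> quarters \<union> (\<otimes>) half_turn ` quarters"
  proof
    fix x assume "x \<in> carrier G"
    then show "x \<in> rotations \<union> involutions \<union> quarters \<union> (\<otimes>) half_turn ` quarters"
    proof (cases x rule: element_cases)
      case 1
      then show ?thesis by simp
    next
      case (2 i)
      then show ?thesis using even_in_involutions by blast
    next
      case (3 i)
      then show ?thesis using odd_in_quarters [of i] by blast
    qed
  qed
  show "rotations \<union> involutions \<union> quarters \<union> (\<otimes>) half_turn ` quarters \<subseteq> carrier G"
    unfolding half_turn_quarters by (auto simp: rotations_def involutions_def quarters_def)
qed

lemma finite_carrier: "finite (carrier G)"
  by (simp add: carrier_eq rotations_def involutions_def quarters_def)

lemma card_parts: "card rotations = 4 * n" "card involutions = 2 * n" "card quarters = n"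
  unfolding rotations_def involutions_def quarters_def
  by (subst card_image; force simp: inj_on_def a_pow_eq_iff)+

lemma odd_quarter:
  assumes "x \<in> quarters \<union> (\<otimes>) half_turn ` quarters"
  obtains i :: nat where "odd i" "x = a [^] i \<otimes> b"
proof -
  obtain k where "x = a [^] (2 * k + 1) \<otimes> b \<or> x = a [^] (2 * n + 2 * k + 1) \<otimes> b"
    using assms unfolding half_turn_quarters by (auto simp: quarters_def)
  then show thesis using that [of "2 * k + 1"] that [of "2 * n + 2 * k + 1"] by auto
qed

text \<open>The shape of a common generator \<open>g\<close> decides: a power of \<open>a\<close>
  puts both vertices into \<open>rotations\<close>, an even exponent before \<open>b\<close> leaves
  only \<open>\<one>\<close> and \<open>g\<close>, an odd one only the four powers of
  \<open>g\<close>. Conversely, each alternative is witnessed by an explicit generator.\<close>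

lemma adjacent_iff_parts:
  assumes "x \<in> carrier G" "y \<in> carrier G" "x \<noteq> y"
  shows "adjacent (enhanced_power_graph G) x y \<longleftrightarrow>
      (x = \<one> \<or> y = \<one> \<or> x \<in> rotations \<and> y \<in> rotations \<or>
       x = half_turn \<and> y \<in> quarters \<union> (\<otimes>) half_turn ` quarters \<or>
       y = half_turn \<and> x \<in> quarters \<union> (\<otimes>) half_turn ` quarters \<or>
       x \<in> quarters \<and> y = half_turn \<otimes> x \<or> y \<in> quarters \<and> x = half_turn \<otimes> y)" (is "?L \<longleftrightarrow> ?R")
proof
  assume ?L
  then obtain g and j k :: nat where g: "g \<in> carrier G" "x = g [^] j" "y = g [^] k"
    using adjacent_enhanced_power_graph [OF group_axioms finite_carrier] by auto
  show ?R
    using g(1)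
  proof (cases g rule: element_cases)
    case 1
    then show ?thesis by (simp add: g nat_pow_pow)
  next
    case (2 i)
    then show ?thesis using pow_even_cases [of i j] pow_even_cases [of i k] assms(3) g by auto
  next
    case (3 i)
    have q: "g \<in> quarters \<or> (\<exists>h\<in>quarters. g = half_turn \<otimes> h)"
      using odd_in_quarters [OF 3(1)] 3(2) by blast
    \<comment> \<open>Multiplication by \<open>half_turn\<close> swaps the two halves, so the
      representative in \<open>quarters\<close> may be \<open>g\<close> or its partner.\<close>
    have cc: "half_turn \<otimes> (half_turn \<otimes> h) = h" if "h \<in> carrier G" for h
      using half_turn_square that by (simp add: m_assoc [symmetric] numeral_2_eq_2)
    have qc: "quarters \<subseteq> carrier G" by (auto simp: carrier_eq)
    have "x \<in> {\<one>, half_turn, g, half_turn \<otimes> g}" "y \<in> {\<one>, half_turn, g, half_turn \<otimes> g}"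
      using pow_odd_cases [OF 3(1)] 3(2) g by auto
    moreover have "g \<in> quarters \<union> (\<otimes>) half_turn ` quarters" "half_turn \<otimes> g \<in> quarters \<union> (\<otimes>) half_turn ` quarters"
      using q cc qc by auto
    moreover have "g \<in> quarters \<or> half_turn \<otimes> g \<in> quarters \<and> g = half_turn \<otimes> (half_turn \<otimes> g)"
      using q cc qc by auto
    ultimately show ?thesis using assms(3) by blast
  qed
next
  have adjI: ?L if "g \<in> carrier G" "x = g [^] j" "y = g [^] k" for g and j k :: nat
    using that assms adjacent_enhanced_power_graph [OF group_axioms finite_carrier] by blast
  have square: "g [^] (2::nat) = half_turn" if "g \<in> quarters \<union> (\<otimes>) half_turn ` quarters" for g
    using that odd_quarter square_odd by metis
  \<comment> \<open>The partner of \<open>g\<close> is its cube, which supplies the exponent 3 in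
    the last two cases.\<close>
  have cube: "g [^] (3::nat) = half_turn \<otimes> g" if "g \<in> quarters" for g
  proof -
    have "g \<in> carrier G" using that by (simp add: carrier_eq)
    then have "g [^] (3::nat) = g [^] (2::nat) \<otimes> g" by (simp add: eval_nat_numeral)
    then show ?thesis using square that by simp
  qed
  assume ?R
  then consider "x = \<one>" | "y = \<one>" | "x \<in> rotations" "y \<in> rotations"
    | "x = half_turn" "y \<in> quarters \<union> (\<otimes>) half_turn ` quarters"
    | "y = half_turn" "x \<in> quarters \<union> (\<otimes>) half_turn ` quarters"
    | "x \<in> quarters" "y = half_turn \<otimes> x" | "y \<in> quarters" "x = half_turn \<otimes> y" by blast
  then show ?L
  proof cases
    case 1 then show ?thesis using adjI [of y 0 1] assms by simp
  next
    case 2 then show ?thesis using adjI [of x 1 0] assms by simp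
  next
    case 3
    then obtain i j :: nat where "x = a [^] i" "y = a [^] j" by (auto simp: rotations_def)
    then show ?thesis using adjI [of a i j] by simp
  next
    case 4 then show ?thesis using adjI [of y 2 1] assms square by simp
  next
    case 5 then show ?thesis using adjI [of x 1 2] assms square by simp
  next
    case 6 then show ?thesis using adjI [of x 1 3] assms cube by simp
  next
    case 7 then show ?thesis using adjI [of y 3 1] assms cube by simp
  qed
qed

lemma rosette: "rosette (enhanced_power_graph G) rotations involutions quarters ((\<otimes>) half_turn) \<one> half_turn"
proof
  let ?\<Gamma> = "enhanced_power_graph G"
  have V: "vertices ?\<Gamma> = carrier G" by (simp add: enhanced_power_graph_def)
  show "vertices ?\<Gamma> = rotations \<union> involutions \<union> quarters \<union> (\<otimes>) half_turn ` quarters"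
    by (simp add: V carrier_eq)
  show "finite rotations" "finite involutions" "finite quarters"
    by (simp_all add: rotations_def involutions_def quarters_def)
  show "rotations \<inter> involutions = {}" "rotations \<inter> quarters = {}" "rotations \<inter> (\<otimes>) half_turn ` quarters = {}"
    unfolding half_turn_quarters unfolding rotations_def involutions_def quarters_def
    using a_pow_not_b by blast+
  have parity: "even i = even j" if "a [^] i \<otimes> b = a [^] j \<otimes> b" for i j :: nat
  proof -
    have "k mod (4 * n) mod 2 = k mod 2" for k :: nat by (rule mod_mod_cancel) simp
    then show ?thesis using that a_pow_b_eq_iff even_iff_mod_2_eq_zero by metis
  qed
  have "x \<notin> quarters \<union> (\<otimes>) half_turn ` quarters" if x: "x \<in> involutions" for x
  proof
    obtain i where i: "x = a [^] (2 * i :: nat) \<otimes> b" using x unfolding involutions_def by blast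
    assume "x \<in> quarters \<union> (\<otimes>) half_turn ` quarters"
    then obtain j :: nat where "odd j" "x = a [^] j \<otimes> b" by (rule odd_quarter)
    then show False using parity [of "2 * i" j] i by simp
  qed
  then show "involutions \<inter> quarters = {}" "involutions \<inter> (\<otimes>) half_turn ` quarters = {}"
    by blast+
  show "quarters \<inter> (\<otimes>) half_turn ` quarters = {}"
  proof -
    \<comment> \<open>Both exponents are below \<open>4 * n\<close>, and \<open>2 * n\<close> lies
      between them, so the residues differ.\<close>
    have "a [^] (2 * i + 1) \<otimes> b \<noteq> a [^] (2 * n + 2 * j + 1) \<otimes> b" if "i < n" "j < n" for i j :: nat
      unfolding a_pow_b_eq_iff using that by simp
    then show ?thesis unfolding half_turn_quarters unfolding quarters_def by blast
  qed
  show "inj_on ((\<otimes>) half_turn) quarters"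
  proof (rule inj_onI)
    fix x y assume "x \<in> quarters" "y \<in> quarters" "half_turn \<otimes> x = half_turn \<otimes> y"
    moreover from this have "x \<in> carrier G" "y \<in> carrier G" by (simp_all add: carrier_eq)
    ultimately show "x = y" by (simp add: Units_eq)
  qed
  have "a [^] (0::nat) \<in> rotations" by (rule a_pow_in_rotations)
  then show "\<one> \<in> rotations" by simp
  show "half_turn \<in> rotations" by (simp add: half_turn_def)
  show "\<one> \<noteq> half_turn" using n_pos a_pow_eq_iff [of 0 "2 * n"] by (simp add: half_turn_def)
  show "\<exists>u v. E = {u, v}" if "E \<in> edges ?\<Gamma>" for E
    using that by (auto simp: enhanced_power_graph_def)
  show "adjacent ?\<Gamma> u v \<longleftrightarrow>
      u \<in> vertices ?\<Gamma> \<and> v \<in> vertices ?\<Gamma> \<and> u \<noteq> v \<and>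
      (u = \<one> \<or> v = \<one> \<or> u \<in> rotations \<and> v \<in> rotations \<or>
       u = half_turn \<and> v \<in> quarters \<union> (\<otimes>) half_turn ` quarters \<or>
       v = half_turn \<and> u \<in> quarters \<union> (\<otimes>) half_turn ` quarters \<or>
       u \<in> quarters \<and> v = half_turn \<otimes> u \<or> v \<in> quarters \<and> u = half_turn \<otimes> v)" for u v
    using adjacent_iff_parts [of u v] adjacent_enhanced_power_graph [OF group_axioms finite_carrier, of u v]
    unfolding V by blast
qed

text \<open>The parts have sizes \<open>4 * n\<close>, \<open>2 * n\<close>, \<open>n\<close> and
  \<open>n\<close>. Since \<open>4 * n > 2\<close>, the clique of rotations has a vertex besides the
  hubs.\<close>

lemma enhanced_power_graph_invariants:
  "min_degree (enhanced_power_graph G) = 1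
   \<and> independence_number (enhanced_power_graph G) = 3 * n + 1
   \<and> matching_number (enhanced_power_graph G) = 3 * n
   \<and> strong_metric_dimension (enhanced_power_graph G) = 8 * n - 3"
proof -
  interpret rosette "enhanced_power_graph G" rotations involutions quarters "(\<otimes>) half_turn" \<one> half_turn
    by (rule rosette)
  have "rotations \<noteq> {\<one>, half_turn}"
  proof
    assume "rotations = {\<one>, half_turn}"
    then have "card rotations \<le> 2" by (simp add: card_insert_if)
    then show False using card_parts n_pos by simp
  qed
  moreover have "involutions \<noteq> {}" "quarters \<noteq> {}" using card_parts n_pos by fastforce+
  ultimately show ?thesis
    using min_degree_eq_1 independence_number_eq matching_number_eq [of "2 * n"]
      strong_metric_dimension_eq card_vertices card_parts by simp
qed

end

section \<open>Normal forms in the presentation\<close>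

context
  fixes R :: "('g word \<times> 'g word) set"
begin

lemma carrier_presented_group: "carrier (presented_group R) = range (\<lambda>w. word_rel R `` {w})"
  by (auto simp: presented_group_def quotient_def)

lemma one_presented_group: "\<one>\<^bsub>presented_group R\<^esub> = word_rel R `` {[]}"
  by (simp add: presented_group_def)

lemma class_eq_iff: "word_rel R `` {u} = word_rel R `` {v} \<longleftrightarrow> word_eq R u v"
  using eq_equiv_class_iff [OF equiv_word_rel, of u v R] by (simp add: word_rel_def)

lemma class_replicate:
  "word_rel R `` {replicate k (x, True)} = word_rel R `` {[(x, True)]} [^]\<^bsub>presented_group R\<^esub> k"
proof (induction k)
  case 0
  interpret group "presented_group R" by (rule group_presented_group)
  show ?case by (simp add: one_presented_group)
next
  case (Suc k)
  interpret group "presented_group R" by (rule group_presented_group)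
  have "word_rel R `` {replicate (Suc k) (x, True)} = word_rel R `` {replicate k (x, True) @ [(x, True)]}"
    by (simp add: replicate_append_same)
  also have "\<dots> = word_rel R `` {[(x, True)]} [^]\<^bsub>presented_group R\<^esub> Suc k"
    by (simp only: mult_presented_group [symmetric] Suc nat_pow_Suc)
  finally show ?case .
qed

lemma class_inverse:
  "word_rel R `` {[(x, False)]} = inv\<^bsub>presented_group R\<^esub> (word_rel R `` {[(x, True)]})"
proof -
  interpret group "presented_group R" by (rule group_presented_group)
  have "word_rel R `` {[(x, False)] @ [(x, True)]} = word_rel R `` {[]}"
    using word_eq.cancel [of R x False] by (simp add: class_eq_iff)
  then show ?thesis
    by (intro inv_equality [symmetric])
      (simp_all add: mult_presented_group one_presented_group carrier_presented_group)
qed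

end

section \<open>A concrete action of the presented group\<close>

abbreviation sd_relations :: "nat \<Rightarrow> (sd_gen word \<times> sd_gen word) set" where
  "sd_relations n \<equiv>
     {(word_a (4 * n), []), (word_b 2, []), (word_b 1 @ word_a 1, word_a (2 * n - 1) @ word_b 1)}"

text \<open>The left regular action of the semidihedral group, with \<open>(i, s)\<close> standing for
  \<open>a\<^sup>i b\<^sup>s\<close>; it keeps normal forms apart.\<close>

fun sd_act :: "nat \<Rightarrow> sd_gen \<times> bool \<Rightarrow> nat \<times> bool \<Rightarrow> nat \<times> bool" where
  "sd_act n (Gen_a, True) (i, s) = ((i + 1) mod (4 * n), s)"
| "sd_act n (Gen_a, False) (i, s) = ((i + (4 * n - 1)) mod (4 * n), s)"
| "sd_act n (Gen_b, _) (i, s) = ((2 * n - 1) * i mod (4 * n), \<not> s)"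

abbreviation sd_action :: "nat \<Rightarrow> sd_gen word \<Rightarrow> nat \<times> bool \<Rightarrow> nat \<times> bool" where
  "sd_action n w \<equiv> foldr (sd_act n) w"

lemma sd_act_less: "n \<ge> 1 \<Longrightarrow> fst (sd_act n l p) < 4 * n"
  by (induction n l p rule: sd_act.induct) simp_all

lemma sd_action_less: "n \<ge> 1 \<Longrightarrow> fst p < 4 * n \<Longrightarrow> fst (sd_action n w p) < 4 * n"
  by (induction w) (simp_all add: sd_act_less)

lemma sd_action_word_a: "i < 4 * n \<Longrightarrow> sd_action n (word_a k) (i, s) = ((i + k) mod (4 * n), s)"
  by (induction k) (simp_all add: mod_Suc_eq)

text \<open>The square of \<open>2 * n - 1\<close> is \<open>4 * n * (n - 1) + 1\<close>. This is
  what makes \<open>b\<close> act as an involution.\<close>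

lemma twist_twist: "(2 * n - 1) * ((2 * n - 1) * i) mod (4 * n) = i mod (4 * n)" if n: "n \<ge> 1" for n i :: nat
proof -
  obtain m where m: "n = Suc m" using n by (cases n) auto
  have "(2 * n - 1) * ((2 * n - 1) * i) = i + 4 * n * (m * i)"
    by (simp add: m algebra_simps)
  then show ?thesis by simp
qed

text \<open>The letters satisfy the relations on reduced pairs, so the action descends to classes of
  words. The first component must be below \<open>4 * n\<close> because letters return reduced
  residues while the empty word changes nothing.\<close>

lemma sd_action_word_eq:
  assumes "word_eq (sd_relations n) u v" "n \<ge> 1" "fst p < 4 * n"
  shows "sd_action n u p = sd_action n v p"
  using assms
proof (induction arbitrary: p rule: word_eq.induct)
  case (append u v u' v')
  then show ?case by (simp add: sd_action_less)
next
  case (cancel x s)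
  obtain i t where p: "p = (i, t)" by (cases p)
  have "Suc ((i + (4 * n - Suc 0)) mod (4 * n)) mod (4 * n) = i"
    "((Suc i mod (4 * n) + (4 * n - Suc 0))) mod (4 * n) = i"
    using cancel by (cases "Suc i = 4 * n"; simp add: mod_simps p)+
  then show ?case using cancel twist_twist [of n i]
    by (cases x; cases s) (simp_all add: p mod_mult_right_eq)
next
  case (relation u v)
  obtain i t where p: "p = (i, t)" by (cases p)
  consider "(u, v) = (word_a (4 * n), [])" | "(u, v) = (word_b 2, [])"
    | "(u, v) = (word_b 1 @ word_a 1, word_a (2 * n - 1) @ word_b 1)"
    using relation by blast
  then show ?case
  proof cases
    case 1
    then show ?thesis using relation by (simp add: p sd_action_word_a del: foldr_replicate)
  next
    case 2
    then show ?thesis using relation twist_twist [of n i]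
      by (simp add: p numeral_2_eq_2 mod_mult_right_eq)
  next
    case 3
    \<comment> \<open>With \<open>c = 2 * n - 1\<close> this is the third relation: adding 1 before
      multiplying by \<open>c\<close> amounts to adding \<open>c\<close> afterwards.\<close>
    have "c * ((i + 1) mod N) mod N = (c * i mod N + c) mod N" for c N :: nat
      by (simp add: mod_simps algebra_simps)
    then show ?thesis using 3 relation by (simp add: p sd_action_word_a del: foldr_replicate)
  qed
qed auto

text \<open>Existence of normal forms follows from the relations by induction over words; their
  distinctness follows from the action.\<close>

lemma semidihedral_group:
  assumes n: "n \<ge> 1"
  defines "a \<equiv> word_rel (sd_relations n) `` {[(Gen_a, True)]}"
    and "b \<equiv> word_rel (sd_relations n) `` {[(Gen_b, True)]}"
  shows "semidihedral_group (semidihedral n) a b n"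
proof -
  let ?R = "sd_relations n"
  let ?G = "semidihedral n"
  let ?c = "\<lambda>w. word_rel ?R `` {w}"
  have G: "?G = presented_group ?R" by (simp add: semidihedral_def)
  interpret group ?G unfolding G by (rule group_presented_group)
  have mult: "?c u \<otimes>\<^bsub>?G\<^esub> ?c v = ?c (u @ v)" for u v
    unfolding G by (rule mult_presented_group)
  have one: "\<one>\<^bsub>?G\<^esub> = ?c []" unfolding G by (rule one_presented_group)
  have car: "?c w \<in> carrier ?G" for w unfolding G carrier_presented_group by blast
  have ab: "a \<in> carrier ?G" "b \<in> carrier ?G" unfolding a_def b_def by (rule car)+
  have pow_a: "?c (word_a k) = a [^]\<^bsub>?G\<^esub> k" and pow_b: "?c (word_b k) = b [^]\<^bsub>?G\<^esub> k" for k
    unfolding a_def b_def G by (rule class_replicate)+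
  have rel: "?c u = ?c v" if "(u, v) \<in> ?R" for u v
    unfolding class_eq_iff using that by (rule word_eq.relation)
  have a_pow: "a [^]\<^bsub>?G\<^esub> (4 * n) = \<one>\<^bsub>?G\<^esub>"
    unfolding pow_a [symmetric] one by (rule rel) simp
  have b_square: "b \<otimes>\<^bsub>?G\<^esub> b = \<one>\<^bsub>?G\<^esub>"
    unfolding b_def mult one by (rule rel) (simp add: numeral_2_eq_2)
  have b_a: "b \<otimes>\<^bsub>?G\<^esub> a = a [^]\<^bsub>?G\<^esub> (2 * n - 1) \<otimes>\<^bsub>?G\<^esub> b"
    unfolding pow_a [symmetric] unfolding a_def b_def mult by (rule rel) simp
  interpret semidihedral_relations ?G a b n
    by unfold_locales (fact n ab a_pow b_square b_a)+
  have N: "?c w \<in> normal_forms" for w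
  proof (induction w)
    case Nil
    show ?case using one_normal_form by (simp only: one)
  next
    case (Cons l w)
    obtain x s where l: "l = (x, s)" by (cases l)
    \<comment> \<open>Inverse letters disappear here: the inverse of \<open>a\<close> is a natural
      power of \<open>a\<close>, and \<open>b\<close> is its own inverse.\<close>
    have "?c [l] \<in> {a [^]\<^bsub>?G\<^esub> (1::nat), a [^]\<^bsub>?G\<^esub> (4 * n - 1), b}"
    proof (cases x)
      case Gen_a
      have "?c [(Gen_a, False)] = a [^]\<^bsub>?G\<^esub> (4 * n - 1)"
        unfolding inv_a [symmetric] unfolding a_def G by (rule class_inverse)
      then show ?thesis using Gen_a ab by (cases s) (simp_all add: l a_def)
    next
      case Gen_b
      have "?c [(Gen_b, False)] = inv\<^bsub>?G\<^esub> b"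
        unfolding b_def G by (rule class_inverse)
      then show ?thesis using Gen_b ab inv_b by (cases s) (simp_all add: l b_def)
    qed
    then have "?c [l] \<otimes>\<^bsub>?G\<^esub> ?c w \<in> normal_forms" using a_pow_mult_normal_form [OF Cons] b_mult_normal_form [OF Cons] by (metis insertE empty_iff)
    then show ?case by (simp only: mult append_Cons append_Nil)
  qed
  \<comment> \<open>The pair \<open>(0, False)\<close> stands for the identity, so acting on it
    reads off the exponent modulo \<open>4 * n\<close> and the presence of \<open>b\<close>.\<close>
  have act: "sd_action n u (0, False) = sd_action n v (0, False)" if "?c u = ?c v" for u v
    using that n unfolding class_eq_iff by (intro sd_action_word_eq) auto
  show ?thesis
  proof unfold_locales
    fix x assume "x \<in> carrier ?G"
    then obtain w where "x = ?c w" unfolding G carrier_presented_group by blast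
    then show "(\<exists>i. x = a [^]\<^bsub>?G\<^esub> (i::nat)) \<or> (\<exists>i. x = a [^]\<^bsub>?G\<^esub> (i::nat) \<otimes>\<^bsub>?G\<^esub> b)"
      using N [of w] by (auto simp: normal_forms_def)
  next
    show "i mod (4 * n) = j mod (4 * n)" if "a [^]\<^bsub>?G\<^esub> i = a [^]\<^bsub>?G\<^esub> j" for i j :: nat
      using act [OF that [folded pow_a]] n by (simp add: sd_action_word_a del: foldr_replicate)
    show "a [^]\<^bsub>?G\<^esub> i \<noteq> a [^]\<^bsub>?G\<^esub> j \<otimes>\<^bsub>?G\<^esub> b" for i j :: nat
    proof
      assume "a [^]\<^bsub>?G\<^esub> i = a [^]\<^bsub>?G\<^esub> j \<otimes>\<^bsub>?G\<^esub> b"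
      then have "?c (word_a i) = ?c (word_a j @ word_b 1)"
        unfolding pow_a mult [symmetric] by (simp add: b_def)
      from act [OF this] show False using n by (simp add: sd_action_word_a del: foldr_replicate)
    qed
  qed
qed

theorem theorem3p34:
  fixes n :: nat
  assumes "n \<ge> 1"
  shows "min_degree (enhanced_power_graph (semidihedral n)) = 1
       \<and> independence_number (enhanced_power_graph (semidihedral n)) = 3 * n + 1
       \<and> matching_number (enhanced_power_graph (semidihedral n)) = 3 * n
       \<and> strong_metric_dimension (enhanced_power_graph (semidihedral n)) = 8 * n - 3"
  by (rule semidihedral_group.enhanced_power_graph_invariants [OF semidihedral_group [OF assms]])

end
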